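(* Let $(g(x),f(x))$ be a Riordan array over $R$, that is, $g\in\mathcal{F}_0$ and $f\in\mathcal{F}_1$. For all integers $n,k\ge 0$, the $(n,k)$-th term $\hat{t}_{n,k}$ of the inversion $(g(x),f(x))^!$ of the Riordan array $(g(x),f(x))$ is given by $$\hat{t}_{n,k}=\frac{(-1)^k}{n+1}\binom{n+1}{k}\Bigl(\bigl(\operatorname{Rev}(xg(x))\bigr)',\; f\bigl(\operatorname{Rev}(xg(x))\bigr)\Bigr)_{n,k},$$ where the last factor is the $(n,k)$-th entry of the Riordan array $\bigl((\operatorname{Rev}(xg(x)))',\,f(\operatorname{Rev}(xg(x)))\bigr)$.
   Context: $R$ is a field of characteristic zero (for concreteness $R=\mathbb{Q}$). $\mathcal{F}_0$ is the set of formal power series $a_0+a_1x+a_2x^2+\cdots\in R[[x]]$ with $a_0\neq 0$, and $\mathcal{F}_1$ is the set of formal power series $a_1x+a_2x^2+\cdots\in R[[x]]$ with $a_1\ne 0$. For $h\in\mathcal{F}_1$, $\operatorname{Rev}(h(x))$ denotes the compositional inverse of $h$, as a power series in $x$. A prime denotes the derivative with respect to $x$, and $[x^n]$ denotes extraction of the coefficient of $x^n$. A Riordan array $(u(x),v(x))$ with $u\in\mathcal{F}_0$, $v\in\mathcal{F}_1$ is the lower-triangular matrix with $(n,k)$-th entry $(u,v)_{n,k}=[x^n]u(x)v(x)^k$, $n,k\ge0$. The bivariate generating function of the Riordan array $(g,f)$ is $G(x,y)=\frac{g(x)}{1-yf(x)}\in R[y][[x]]$. The inversion $(g(x),f(x))^!$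 is the array $(\hat{t}_{n,k})_{n,k\ge0}$ defined by $\sum_{n,k\ge0}\hat{t}_{n,k}x^ny^k=\frac1x\operatorname{Rev}_x\bigl(xG(x,y)\bigr)$, where $\operatorname{Rev}_x$ denotes the compositional inverse in the variable $x$ (with $y$ fixed): $U(x,y)=\operatorname{Rev}_x(xG(x,y))$ is the unique series in $R[y][[x]]$ with $U(0,y)=0$ and $U(x,y)\,G(U(x,y),y)=x$. *)

theory Defs
  imports "HOL-Computational_Algebra.Computational_Algebra"
begin

definition F0 :: "'a::zero fps set" where
  "F0 = {u. u $ 0 \<noteq> 0}"

definition F1 :: "'a::zero fps set" where
  "F1 = {v. v $ 0 = 0 \<and> v $ 1 \<noteq> 0}"

definition riordan_array :: "'a::comm_ring_1 fps \<Rightarrow> 'a fps \<Rightarrow> nat \<Rightarrow> nat \<Rightarrow> 'a" where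
  "riordan_array u v n k = (u * v ^ k) $ n"

(* Bivariate series in R[y][[x]] have type 'a poly fps: the fps variable is x and
   the polynomial variable is y = [:0, 1:]. *)

definition lift_fps :: "'a::zero fps \<Rightarrow> 'a poly fps" where
  "lift_fps h = Abs_fps (\<lambda>n. [:h $ n:])"

(* g(x) / (1 - y f(x)). The type 'a poly has no inverse operation, so the reciprocal is
   taken with fps_right_inverse; its second argument is the inverse of the constant term
   of the denominator, which is 1 when f $ 0 = 0. *)

definition riordan_gf :: "'a::comm_ring_1 fps \<Rightarrow> 'a fps \<Rightarrow> 'a poly fps" where
  "riordan_gf g f =
     lift_fps g * fps_right_inverse (1 - fps_const [:0, 1:] * lift_fps f) 1"

(* Compositional inverse over a commutative ring; the library's fps_inv needs a field and
   so does not apply to coefficients in R[y]. *)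

definition fps_rev :: "'a::comm_ring_1 fps \<Rightarrow> 'a fps" where
  "fps_rev h = (THE U. U $ 0 = 0 \<and> h oo U = fps_X)"

definition riordan_inversion :: "'a::comm_ring_1 fps \<Rightarrow> 'a fps \<Rightarrow> nat \<Rightarrow> nat \<Rightarrow> 'a" where
  "riordan_inversion g f n k =
     coeff (fps_shift 1 (fps_rev (fps_X * riordan_gf g f)) $ n) k"

lemma riordan_gf_eq:
  assumes "f $ 0 = 0"
  shows "riordan_gf g f * (1 - fps_const [:0, 1:] * lift_fps f) = lift_fps g"
proof -
  let ?d = "1 - fps_const [:0, 1:] * lift_fps f"
  have "?d $ 0 * 1 = 1"
    using assms by (simp add: lift_fps_def)
  then have "?d * fps_right_inverse ?d 1 = 1"
    by (rule fps_right_inverse)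
  then have "lift_fps g * (?d * fps_right_inverse ?d 1) = lift_fps g"
    by (simp only: mult_1_right)
  then show ?thesis
    unfolding riordan_gf_def by (simp only: mult_ac)
qed

lemma fps_left_compinv_exists:
  fixes h :: "'a::comm_ring_1 fps"
  assumes h0: "h $ 0 = 0" and c: "h $ 1 * c = 1"
  shows "\<exists>W. W $ 0 = 0 \<and> W $ 1 = c \<and> W oo h = fps_X"
proof -
  define w where "w = wfrec less_than
    (\<lambda>w n. (fps_X $ n - (\<Sum>i<n. w i * (h ^ i) $ n)) * c ^ n)"
  have w: "w n = (fps_X $ n - (\<Sum>i<n. w i * (h ^ i) $ n)) * c ^ n" for n
    unfolding w_def by (subst wfrec) (auto simp: cut_apply intro!: sum.cong)
  have hn: "(h ^ n) $ n * c ^ n = 1" for n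
    using h0 c by (simp add: startsby_zero_power_nth_same flip: power_mult_distrib)
  have "(Abs_fps w oo h) $ n = fps_X $ n" for n
  proof -
    have "(Abs_fps w oo h) $ n = (\<Sum>i<n. w i * (h ^ i) $ n) + w n * (h ^ n) $ n"
      by (simp add: fps_compose_nth atLeast0AtMost lessThan_Suc_atMost [symmetric])
    also have "w n * (h ^ n) $ n =
        (fps_X $ n - (\<Sum>i<n. w i * (h ^ i) $ n)) * ((h ^ n) $ n * c ^ n)"
      by (subst w) (simp add: mult_ac)
    finally show ?thesis by (simp add: hn)
  qed
  moreover have w0: "w 0 = 0"
    by (subst w) simp
  moreover have "w 1 = c"
    by (subst w) (simp add: w0)
  ultimately show ?thesis
    by (intro exI [of _ "Abs_fps w"]) (auto intro: fps_ext)
qed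

lemma fps_rev_ex1:
  fixes h :: "'a::idom fps"
  assumes h0: "h $ 0 = 0" and unit: "h $ 1 dvd 1"
  shows "\<exists>!U. U $ 0 = 0 \<and> h oo U = fps_X"
proof -
  obtain c where c: "h $ 1 * c = 1"
    using unit by (auto elim: dvdE)
  obtain W where W: "W $ 0 = 0" "W $ 1 = c" "W oo h = fps_X"
    using fps_left_compinv_exists [OF h0 c] by blast
  obtain V where V: "V $ 0 = 0" "V oo W = fps_X"
    using fps_left_compinv_exists [OF W(1), of "h $ 1"] W(2) c by (auto simp: mult.commute)
  have "V = V oo (W oo h)"
    by (simp add: W)
  also have "\<dots> = h"
    by (simp add: fps_compose_assoc h0 W(1) V(2))
  finally have "h oo W = fps_X"
    using V by simp
  moreover have "U = W" if "U $ 0 = 0" "h oo U = fps_X" for U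
  proof -
    have "W = W oo (h oo U)"
      by (simp add: that)
    also have "\<dots> = U"
      by (simp add: fps_compose_assoc h0 that(1) W(3))
    finally show ?thesis by simp
  qed
  ultimately show ?thesis
    using W(1) by blast
qed

end

theory Submission
  imports Defs
begin

text \<open>
  Write \<open>r\<close> for the compositional inverse of \<open>x g(x)\<close> and \<open>h = x g / (1 - y f)\<close>. The inverse \<open>U\<close> of
  \<open>h\<close> satisfies \<open>U \<circ> h = x\<close>, and composing with \<open>r\<close> on the right gives \<open>U \<circ> w = r\<close> with
  \<open>w = h \<circ> r = x / (1 - y f(r))\<close>. Lagrange inversion then yields
  \<open>(n + 1) [x\<^sup>n\<^sup>+\<^sup>1] U = [x\<^sup>n] r' (1 - y f(r))\<^sup>n\<^sup>+\<^sup>1\<close>, and the binomial theorem extracts the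
  coefficient of \<open>y\<^sup>k\<close>.
\<close>

text \<open>Since \<open>b ^ i\<close> has order at least i, terms with i > n contribute nothing in
  degrees up to n. The one bound n thus serves all these coefficients of \<open>a oo b\<close>, and
  the two finite sums can be swapped.\<close>

lemma fps_compose_mult_nth:
  fixes a b c :: "'a::comm_ring_1 fps"
  assumes b0: "b $ 0 = 0"
  shows "((a oo b) * c) $ n = (\<Sum>i\<le>n. a $ i * (b ^ i * c) $ n)"
proof -
  have comp: "(a oo b) $ j = (\<Sum>i\<le>n. a $ i * (b ^ i) $ j)" if "j \<le> n" for j
    unfolding fps_compose_nth using that startsby_zero_power_prefix [OF b0]
    by (intro sum.mono_neutral_left) auto
  have "((a oo b) * c) $ n = (\<Sum>j\<le>n. (\<Sum>i\<le>n. a $ i * (b ^ i) $ j) * c $ (n - j))"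
    unfolding fps_mult_nth by (intro sum.cong) (auto simp: comp)
  also have "\<dots> = (\<Sum>i\<le>n. a $ i * (b ^ i * c) $ n)"
    unfolding sum_distrib_right fps_mult_nth sum_distrib_left
    by (subst sum.swap) (simp add: mult.assoc atLeast0AtMost)
  finally show ?thesis .
qed

text \<open>A residue computation without Laurent series: for w = \<open>fps_X * \<psi>\<close> we
  have \<phi> = x/w, so the coefficient is the residue of w'/w^(p+1). It is 1 for the logarithmic
  derivative (p = 0), and 0 otherwise, the form being exact.\<close>

lemma fps_deriv_times_power_nth:
  fixes \<phi> \<psi> :: "'a::{idom,ring_char_0} fps"
  assumes inv: "\<phi> * \<psi> = 1"
  shows "(fps_deriv (fps_X * \<psi>) * \<phi> ^ Suc p) $ p = (if p = 0 then 1 else 0)"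
proof (cases p)
  case 0
  have "(\<phi> * \<psi>) $ 0 = 1"
    by (simp add: inv)
  with 0 show ?thesis
    by (simp add: mult.commute)
next
  case (Suc q)
  have "fps_deriv (\<phi> * \<psi>) = 0"
    by (simp add: inv)
  then have d: "\<phi> * fps_deriv \<psi> = - (fps_deriv \<phi> * \<psi>)"
    by (simp add: add_eq_0_iff2 algebra_simps)
  have "fps_deriv (fps_X * \<psi>) * \<phi> ^ Suc p
      = (\<phi> * \<psi>) * \<phi> ^ p + fps_X * (\<phi> * fps_deriv \<psi>) * \<phi> ^ p"
    by (simp add: algebra_simps)
  also have "\<dots> = \<phi> ^ p - fps_X * fps_deriv \<phi> * (\<phi> * \<psi>) * \<phi> ^ q"
    unfolding d by (simp add: inv Suc algebra_simps)
  also have "\<dots> = \<phi> ^ p - fps_X * (fps_deriv \<phi> * \<phi> ^ q)"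
    by (simp add: inv algebra_simps)
  finally have e: "fps_deriv (fps_X * \<psi>) * \<phi> ^ Suc p = \<phi> ^ p - fps_X * (fps_deriv \<phi> * \<phi> ^ q)" .
  \<comment> \<open>The operator x d/dx multiplies the coefficient of degree p by p. Hence the two
    terms in \<open>e\<close> agree in degree p once the nonzero factor p is cancelled.\<close>
  have "of_nat p * (fps_X * (fps_deriv \<phi> * \<phi> ^ q)) = fps_X * fps_deriv (\<phi> ^ p)"
    by (simp only: fps_deriv_power Suc fps_of_nat diff_Suc_1 mult_ac)
  moreover have "(fps_X * fps_deriv (\<phi> ^ p)) $ p = of_nat p * (\<phi> ^ p) $ p"
    using Suc by (simp del: power_Suc of_nat_Suc fps_deriv_power)
  ultimately have "of_nat p * (fps_X * (fps_deriv \<phi> * \<phi> ^ q)) $ p = of_nat p * (\<phi> ^ p) $ p"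
    by (metis fps_mult_of_nat_nth(1))
  then have "(fps_X * (fps_deriv \<phi> * \<phi> ^ q)) $ p = (\<phi> ^ p) $ p"
    using Suc by (simp del: of_nat_Suc)
  then show ?thesis
    unfolding e using Suc by (simp del: power_Suc)
qed

text \<open>Lagrange inversion with the inverse series left implicit: S is recovered from S oo w,
  where w = \<open>fps_X * \<psi>\<close>. Expanding (S oo w)' as the sum of S'_i w^i w', the
  residue lemma isolates i = n. Only \<phi> * \<psi> = 1 is needed, so coefficients in R[y] are
  allowed.\<close>

lemma lagrange_buermann:
  fixes S \<phi> \<psi> :: "'a::{idom,ring_char_0} fps"
  assumes inv: "\<phi> * \<psi> = 1"
  shows "(fps_deriv (S oo (fps_X * \<psi>)) * \<phi> ^ Suc n) $ n = of_nat (Suc n) * S $ Suc n"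
proof -
  define w where "w = fps_X * \<psi>"
  have w0: "w $ 0 = 0"
    by (simp add: w_def)
  \<comment> \<open>The factor \<open>w ^ i\<close> cancels i of the powers of \<phi>, leaving
    \<open>fps_X ^ i\<close>; this shift reduces the claim to the residue lemma at p = n -
    i.\<close>
  have step: "(w ^ i * (fps_deriv w * \<phi> ^ Suc n)) $ n = (if i = n then 1 else 0)" if "i \<le> n" for i
  proof -
    have "w ^ i * \<phi> ^ i = fps_X ^ i * (\<phi> * \<psi>) ^ i"
      by (simp add: w_def power_mult_distrib mult_ac)
    then have "w ^ i * \<phi> ^ i = fps_X ^ i"
      by (simp add: inv)
    moreover have "\<phi> ^ Suc n = \<phi> ^ i * \<phi> ^ Suc (n - i)"
      using that by (simp flip: power_add)
    ultimately have "w ^ i * (fps_deriv w * \<phi> ^ Suc n) = fps_X ^ i * (fps_deriv w * \<phi> ^ Suc (n - i))"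
      by (metis mult.assoc mult.left_commute)
    then have "(w ^ i * (fps_deriv w * \<phi> ^ Suc n)) $ n = (fps_deriv w * \<phi> ^ Suc (n - i)) $ (n - i)"
      using that by (simp only: fps_X_power_mult_nth not_less [symmetric] if_False)
    also have "\<dots> = (if i = n then 1 else 0)"
      unfolding w_def fps_deriv_times_power_nth [OF inv] using that by auto
    finally show ?thesis .
  qed
  have "(fps_deriv (S oo w) * \<phi> ^ Suc n) $ n
      = ((fps_deriv S oo w) * (fps_deriv w * \<phi> ^ Suc n)) $ n"
    by (simp only: fps_compose_deriv [OF w0] mult.assoc)
  also have "\<dots> = (\<Sum>i\<le>n. fps_deriv S $ i * (if i = n then 1 else 0))"
    unfolding fps_compose_mult_nth [OF w0] by (intro sum.cong) (auto simp only: step atMost_iff)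
  also have "\<dots> = of_nat (Suc n) * S $ Suc n"
    by (simp add: if_distrib cong: if_cong)
  finally show ?thesis
    by (simp only: w_def)
qed

lemma lift_fps_nth [simp]: "lift_fps h $ n = [:h $ n:]"
  by (simp add: lift_fps_def)

lemma lift_fps_X [simp]: "lift_fps fps_X = fps_X"
  by (intro fps_ext) simp

lemma lift_fps_1 [simp]: "lift_fps 1 = 1"
  by (intro fps_ext) simp

lemma lift_fps_mult: "lift_fps (a * b) = lift_fps a * lift_fps (b :: 'a::comm_ring_1 fps)"
  by (intro fps_ext) (simp add: fps_mult_nth mult.commute flip: sum_to_poly)

lemma lift_fps_power: "lift_fps (a ^ k) = lift_fps (a :: 'a::comm_ring_1 fps) ^ k"
  by (induction k) (simp_all add: lift_fps_mult)

lemma lift_fps_compose: "lift_fps (a oo b) = lift_fps a oo lift_fps (b :: 'a::comm_ring_1 fps)"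
  by (intro fps_ext) (simp add: fps_compose_nth mult.commute flip: lift_fps_power sum_to_poly)

lemma lift_fps_deriv: "lift_fps (fps_deriv a) = fps_deriv (lift_fps (a :: 'a::comm_ring_1 fps))"
  by (intro fps_ext) (simp add: of_nat_poly flip: of_nat_Suc)

text \<open>\<open>fps_rev\<close> is specified as a right inverse. A left inverse W exists because
  the linear coefficient is a unit, and associativity forces the two to coincide.\<close>

lemma fps_rev_compose:
  fixes h :: "'a::idom fps"
  assumes h0: "h $ 0 = 0" and unit: "h $ 1 dvd 1"
  shows "fps_rev h oo h = fps_X"
proof -
  have U: "fps_rev h $ 0 = 0" "h oo fps_rev h = fps_X"
    using theI' [OF fps_rev_ex1 [OF assms]] by (simp_all add: fps_rev_def)
  obtain c where "h $ 1 * c = 1"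
    using unit by (auto elim: dvdE)
  then obtain W where W: "W oo h = fps_X"
    using fps_left_compinv_exists [OF h0] by blast
  have "W = W oo (h oo fps_rev h)"
    by (simp add: U)
  also have "\<dots> = fps_rev h"
    by (simp add: fps_compose_assoc h0 U(1) W)
  finally show ?thesis
    using W by simp
qed

theorem proposition8:
  fixes g f :: "'a::field_char_0 fps" and n k :: nat
  assumes "g \<in> F0" and "f \<in> F1"
  shows "riordan_inversion g f n k =
    (-1) ^ k / of_nat (n + 1) * of_nat ((n + 1) choose k) *
    riordan_array (fps_deriv (fps_inv (fps_X * g))) (f oo fps_inv (fps_X * g)) n k"
proof -
  define r where "r = fps_inv (fps_X * g)"
  define F where "F = f oo r"
  define y :: "'a poly fps" where "y = fps_const [:0, 1:]"
  define G where "G = riordan_gf g f"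
  define U where "U = fps_rev (fps_X * G)"
  define L where "L = lift_fps r"
  define \<phi> where "\<phi> = 1 - y * lift_fps F"
  define \<psi> where "\<psi> = fps_right_inverse \<phi> 1"
  have g0: "g $ 0 \<noteq> 0" and f0: "f $ 0 = 0"
    using assms by (auto simp: F0_def F1_def)
  have r0: "r $ 0 = 0"
    by (simp add: r_def fps_inv_def)
  have L0: "L $ 0 = 0"
    by (simp add: L_def r0)
  have F00: "F $ 0 = 0"
    by (simp add: F_def f0)
  have inv: "\<phi> * \<psi> = 1"
    unfolding \<psi>_def by (rule fps_right_inverse) (simp add: \<phi>_def y_def F00)
  have G: "G * (1 - y * lift_fps f) = lift_fps g"
    unfolding G_def y_def by (rule riordan_gf_eq) (rule f0)
  \<comment> \<open>The linear coefficient of \<open>fps_X * G\<close> is a nonzero constant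
    polynomial, hence a unit of R[y].\<close>
  have "(G * (1 - y * lift_fps f)) $ 0 = [:g $ 0:]"
    by (simp add: G)
  then have "G $ 0 = [:g $ 0:]"
    by (simp add: f0)
  then have U: "U oo (fps_X * G) = fps_X"
    unfolding U_def using g0 by (intro fps_rev_compose) (auto simp: is_unit_pCons_iff)
  \<comment> \<open>With the denominator cleared, composing with \<open>L\<close> only involves
    products: the right side becomes x, and 1 - y f becomes \<phi> because y is constant in
    x.\<close>
  have "fps_X * G * (1 - y * lift_fps f) = lift_fps (fps_X * g)"
    by (simp add: G lift_fps_mult mult.assoc)
  then have "(fps_X * G * (1 - y * lift_fps f)) oo L = lift_fps ((fps_X * g) oo r)"
    by (simp add: L_def lift_fps_compose)
  also have "(fps_X * g) oo r = fps_X"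
    unfolding r_def using g0 by (intro fps_inv_right) auto
  also have "(fps_X * G * (1 - y * lift_fps f)) oo L = ((fps_X * G) oo L) * \<phi>"
    by (simp only: fps_compose_mult_distrib [OF L0] fps_compose_sub_distrib)
       (simp add: \<phi>_def F_def lift_fps_compose L_def y_def fps_const_mult_apply_left)
  finally have "((fps_X * G) oo L) * \<phi> = fps_X"
    by simp
  then have w: "(fps_X * G) oo L = fps_X * \<psi>"
    by (metis inv mult.assoc mult.right_neutral)
  have "U oo (fps_X * \<psi>) = (U oo (fps_X * G)) oo L"
    unfolding w [symmetric] by (rule fps_compose_assoc) (auto simp: L0)
  then have UL: "U oo (fps_X * \<psi>) = L"
    by (simp add: U L0)
  \<comment> \<open>All powers of y are collected in one \<open>monom\<close> per summand, so that
    the coefficient of y^k later selects a single term.\<close>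
  have \<phi>_power: "\<phi> ^ Suc n = (\<Sum>j\<le>Suc n. fps_const (monom (of_nat (Suc n choose j) * (-1) ^ j) j) * lift_fps (F ^ j))"
  proof -
    have "\<phi> ^ Suc n = (- y * lift_fps F + 1) ^ Suc n"
      by (simp add: \<phi>_def)
    also have "\<dots> = (\<Sum>j\<le>Suc n. of_nat (Suc n choose j) * (- y * lift_fps F) ^ j)"
      unfolding binomial_ring by simp
    also have "\<dots> = (\<Sum>j\<le>Suc n. fps_const (monom (of_nat (Suc n choose j) * (-1) ^ j) j) * lift_fps (F ^ j))"
    proof (intro sum.cong refl)
      fix j
      have "of_nat (Suc n choose j) * (- y) ^ j = fps_const (monom (of_nat (Suc n choose j) * (-1) ^ j) j)"
      proof -
        have "- y = fps_const (monom (- 1) 1)"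
          by (simp add: y_def monom_Suc monom_0)
        moreover have "(of_nat c :: 'a poly fps) = fps_const (monom (of_nat c) 0)" for c
          by (simp add: monom_0 of_nat_poly flip: fps_of_nat)
        ultimately show ?thesis
          by (simp add: fps_const_power monom_power mult_monom)
      qed
      then show "of_nat (Suc n choose j) * (- y * lift_fps F) ^ j
          = fps_const (monom (of_nat (Suc n choose j) * (-1) ^ j) j) * lift_fps (F ^ j)"
        by (simp only: power_mult_distrib lift_fps_power flip: mult.assoc)
    qed
    finally show ?thesis .
  qed
  \<comment> \<open>The inversion divides U by x, so its n-th row is the coefficient of U at
    \<open>Suc n\<close>.\<close>
  have "of_nat (Suc n) * U $ Suc n = (fps_deriv L * \<phi> ^ Suc n) $ n"
    using lagrange_buermann [OF inv, of U n] by (simp only: UL)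
  also have "\<dots> = (\<Sum>j\<le>Suc n. monom (of_nat (Suc n choose j) * (-1) ^ j * (fps_deriv r * F ^ j) $ n) j)"
  proof -
    have "(fps_deriv L * (fps_const (monom c j) * lift_fps (F ^ j))) $ n
        = monom (c * (fps_deriv r * F ^ j) $ n) j" for c j
    proof -
      have "fps_deriv L * (fps_const (monom c j) * lift_fps (F ^ j))
          = fps_const (monom c j) * lift_fps (fps_deriv r * F ^ j)"
        by (simp add: L_def lift_fps_mult lift_fps_deriv mult_ac)
      then show ?thesis
        by (simp only: fps_mult_left_const_nth lift_fps_nth)
           (simp add: monom_0 [symmetric] mult_monom del: monom_0)
    qed
    then show ?thesis
      by (simp only: \<phi>_power sum_distrib_left fps_sum_nth)
  qed
  finally have "coeff (of_nat (Suc n) * U $ Suc n) k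
      = (\<Sum>j\<le>Suc n. if j = k then of_nat (Suc n choose j) * (-1) ^ j * (fps_deriv r * F ^ j) $ n else 0)"
    by (simp only: coeff_sum coeff_monom)
  \<comment> \<open>For k > \<open>Suc n\<close> no summand matches, and the binomial coefficient is
    0 as well.\<close>
  also have "\<dots> = of_nat (Suc n choose k) * (-1) ^ k * (fps_deriv r * F ^ k) $ n"
    by (auto simp: binomial_eq_0 simp del: binomial_Suc_Suc)
  also have "coeff (of_nat (Suc n) * U $ Suc n) k = of_nat (Suc n) * coeff (U $ Suc n) k"
    by (simp add: of_nat_poly del: of_nat_Suc)
  finally have "coeff (U $ Suc n) k
      = (-1) ^ k / of_nat (Suc n) * of_nat (Suc n choose k) * (fps_deriv r * F ^ k) $ n"
    by (simp add: field_simps del: of_nat_Suc binomial_Suc_Suc)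
  then show ?thesis
    by (simp only: riordan_inversion_def riordan_array_def U_def G_def F_def r_def
        fps_shift_nth Suc_eq_plus1)
qed

end
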